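(* For every $m\ge3$, $|\mathbf K_m(v)|$ has the form $$|\mathbf K_m(v)|=\frac{(1-v)^{m-2}+P_m(x,v)}{(1-v)^{m-2}},$$ where $P_m(x,v)$ is a polynomial in $x$ and $v$ that is not identically zero, satisfies $P_m(0,v)=0$, and is not divisible by $1-v$.
   Context: For $m\ge1$, $\mathbf K_m(v)$ is the $m\times m$ matrix with entries in $\mathbb{Q}(x,v)$ defined as follows. - All diagonal entries equal $1-xv$, except the $(m,m)$ entry, which equals $1-xv+\frac{xv}{1-v}$. - All entries strictly above the diagonal equal $-xv$. - The entries at positions $(i+1,i)$ equal $\frac{xv}{1-v}$. - All other entries are $0$. $|\cdot|$ denotes the determinant. *)

theory Defs
  imports
    "HOL-Computational_Algebra.Polynomial_Factorial"
    "Jordan_Normal_Form.Determinant"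
begin

text \<open>
  The polynomial ring \<open>\<rat>[x, v]\<close> is represented as \<open>\<rat>[v][x]\<close>, i.e. by the type \<^typ>\<open>rat poly poly\<close>
  whose outer indeterminate is \<open>x\<close> and whose inner indeterminate is \<open>v\<close>. So \<open>poly P 0\<close> is the
  polynomial \<open>P(0, v)\<close>. The field \<open>\<rat>(x, v)\<close> is its field of fractions.
\<close>

definition X :: "rat poly poly"
  where "X = [:0, 1:]"

definition V :: "rat poly poly"
  where "V = [:[:0, 1:]:]"

abbreviation xx :: "rat poly poly fract"
  where "xx \<equiv> to_fract X"

abbreviation vv :: "rat poly poly fract"
  where "vv \<equiv> to_fract V"

text \<open>Indices start at 0, so the last diagonal position is \<open>(m - 1, m - 1)\<close>.\<close>

definition K_mat :: "nat \<Rightarrow> rat poly poly fract mat"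
  where "K_mat m = mat m m (\<lambda>(i, j).
    if i = j then (if i + 1 = m then 1 - xx * vv + xx * vv / (1 - vv) else 1 - xx * vv)
    else if i < j then - (xx * vv)
    else if i = j + 1 then xx * vv / (1 - vv)
    else 0)"

end

theory Submission
  imports Defs
begin

text \<open>
  Subtracting the second row from the first leaves only two nonzero entries in the first row.
  Hence, with \<open>a = x v\<close> and \<open>b = x v / (1 - v)\<close>, the determinants satisfy
  \<open>D\<^sub>m = (1 - a - b) D\<^sub>m\<^sub>-\<^sub>1 + b D\<^sub>m\<^sub>-\<^sub>2\<close> for \<open>m \<ge> 3\<close>. The terms in \<open>b\<^sup>2\<close> of \<open>D\<^sub>3\<close> cancel, which saves one
  power of \<open>1 - v\<close> in the denominator. The numerator \<open>N\<^sub>m = (1 - v)\<^sup>m\<^sup>-\<^sup>2 D\<^sub>m\<close> satisfies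
  \<open>N\<^sub>m = -x N\<^sub>m\<^sub>-\<^sub>1\<close> at \<open>v = 1\<close> for \<open>m \<ge> 5\<close>. At \<open>x = 2\<close>, \<open>v = 1\<close> both \<open>N\<^sub>3 = -6\<close> and \<open>N\<^sub>4 = 16\<close> are
  nonzero, so no \<open>N\<^sub>m\<close> vanishes there, whereas \<open>1 - v\<close> does.
\<close>

lemma K_mat_carrier: "K_mat m \<in> carrier_mat m m"
  by (simp add: K_mat_def)

lemma det_K_mat_1: "det (K_mat 1) = 1 - xx * vv + xx * vv / (1 - vv)"
  by (subst det_single) (auto simp: K_mat_def)

lemma det_K_mat_2: "det (K_mat 2) = (1 - xx * vv)\<^sup>2 + xx * vv / (1 - vv)"
proof -
  have cofactors: "cofactor (K_mat 2) 0 0 = K_mat 2 $$ (1, 1)"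
      "cofactor (K_mat 2) 0 1 = - K_mat 2 $$ (1, 0)"
    unfolding cofactor_def by (subst det_single; simp add: K_mat_def mat_delete_def)+
  have "det (K_mat 2) = (\<Sum>j<2. K_mat 2 $$ (0, j) * cofactor (K_mat 2) 0 j)"
    by (rule laplace_expansion_row[OF K_mat_carrier]) simp
  also have "\<dots> = K_mat 2 $$ (0, 0) * cofactor (K_mat 2) 0 0
      + K_mat 2 $$ (0, 1) * cofactor (K_mat 2) 0 1"
    by (simp add: numeral_2_eq_2)
  also have "\<dots> = (1 - xx * vv) * (1 - xx * vv + xx * vv / (1 - vv))
      + xx * vv * (xx * vv / (1 - vv))"
    unfolding cofactors by (simp add: K_mat_def)
  also have "\<dots> = (1 - xx * vv)\<^sup>2 + xx * vv / (1 - vv)"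
    by (simp only: distrib_left left_diff_distrib right_diff_distrib power2_eq_square)
  finally show ?thesis .
qed

lemma det_K_mat_rec:
  "det (K_mat (k + 3)) = (1 - xx * vv - xx * vv / (1 - vv)) * det (K_mat (k + 2))
     + xx * vv / (1 - vv) * det (K_mat (k + 1))"
proof -
  define a where "a = xx * vv"
  define b where "b = xx * vv / (1 - vv)"
  define B where "B = addrow (-1) 0 1 (K_mat (k + 3))"
  define C where "C = mat_delete B 0 1"
  have entry: "K_mat n $$ (i, j) = (if i = j then (if i + 1 = n then 1 - a + b else 1 - a)
      else if i < j then - a else if i = j + 1 then b else 0)" if "i < n" "j < n" for n i j
    using that by (simp add: K_mat_def a_def b_def)
  have B: "B \<in> carrier_mat (k + 3) (k + 3)"
    by (simp add: B_def K_mat_def)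
  have C: "C \<in> carrier_mat (k + 2) (k + 2)"
    using B by (simp add: C_def mat_delete_def)
  \<comment> \<open>The size is at least 3, so position \<open>(1, 1)\<close> is not the exceptional
    corner, and the row difference there is \<open>- a - (1 - a) = -1\<close>.\<close>
  have B_entry: "B $$ (i, j) = (if i = 0 then if j = 0 then 1 - a - b else if j = 1 then -1 else 0
      else K_mat (k + 3) $$ (i, j))" if "i < k + 3" "j < k + 3" for i j
    using that by (auto simp: B_def K_mat_carrier[THEN carrier_matD(1)]
        K_mat_carrier[THEN carrier_matD(2)] entry)
  have delete_B: "mat_delete B 0 0 = K_mat (k + 2)"
    by (rule eq_matI) (use B in \<open>auto simp: mat_delete_def B_entry entry
        K_mat_carrier[THEN carrier_matD(1)] K_mat_carrier[THEN carrier_matD(2)]\<close>)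
  have delete_C: "mat_delete C 0 0 = K_mat (k + 1)"
    by (rule eq_matI) (use B in \<open>auto simp: C_def mat_delete_def B_entry entry
        K_mat_carrier[THEN carrier_matD(1)] K_mat_carrier[THEN carrier_matD(2)]\<close>)
  \<comment> \<open>This column is column 0 of \<open>B\<close> without its top entry, so only the
    subdiagonal \<open>b\<close> survives.\<close>
  have C_entry: "C $$ (i, 0) = (if i = 0 then b else 0)" if "i < k + 2" for i
    using that B by (auto simp: C_def mat_delete_def B_entry entry)
  have "det C = (\<Sum>i<k+2. C $$ (i, 0) * cofactor C i 0)"
    by (rule laplace_expansion_column[OF C]) simp
  also have "\<dots> = (\<Sum>i\<in>{0}. C $$ (i, 0) * cofactor C i 0)"
    by (rule sum.mono_neutral_right) (auto simp: C_entry)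
  also have "\<dots> = b * det (K_mat (k + 1))"
    by (simp add: C_entry cofactor_def delete_C)
  finally have det_C: "det C = b * det (K_mat (k + 1))" .
  have "det (K_mat (k + 3)) = det B"
    unfolding B_def by (rule det_addrow[symmetric, OF _ _ K_mat_carrier]) auto
  also have "\<dots> = (\<Sum>j<k+3. B $$ (0, j) * cofactor B 0 j)"
    by (rule laplace_expansion_row[OF B]) simp
  also have "\<dots> = (\<Sum>j\<in>{0,1}. B $$ (0, j) * cofactor B 0 j)"
    by (rule sum.mono_neutral_right) (auto simp: B_entry)
  \<comment> \<open>The entry -1 cancels the cofactor sign at \<open>(0, 1)\<close>.\<close>
  also have "\<dots> = (1 - a - b) * det (K_mat (k + 2)) + det C"
    by (simp add: B_entry cofactor_def delete_B C_def)
  finally show ?thesis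
    by (simp add: det_C a_def b_def)
qed

text \<open>Numerators for size \<open>k + 3\<close> over \<open>(1 - v) ^ (k + 1)\<close>. The
  recursion cannot start lower: at size 2 the allowed denominator is 1, but the determinant still
  has \<open>1 - v\<close> in its denominator.\<close>

fun K_num :: "nat \<Rightarrow> rat poly poly" where
  "K_num 0 = (1 - V) * (1 - X * V) ^ 3 + X * V * (1 - (X * V)\<^sup>2)"
| "K_num (Suc 0) = (1 - V)\<^sup>2 * (1 - X * V) ^ 4
     + (1 - V) * X * V * (1 - X * V) * (1 + X * V - 2 * (X * V)\<^sup>2) + (X * V) ^ 4"
| "K_num (Suc (Suc k)) = ((1 - V) * (1 - X * V) - X * V) * K_num (Suc k)
     + X * V * (1 - V) * K_num k"

lemma one_minus_vv_nonzero: "1 - vv \<noteq> 0"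
proof -
  have "1 - V \<noteq> 0"
    by (simp add: V_def one_pCons)
  then show ?thesis
    by (metis to_fract_1 to_fract_diff to_fract_eq_0_iff)
qed

lemma to_fract_power: "to_fract (p ^ n) = to_fract p ^ n"
  by (induction n) simp_all

lemma det_K_mat: "det (K_mat (k + 3)) * (1 - vv) ^ (k + 1) = to_fract (K_num k)"
proof -
  define a where "a = xx * vv"
  define b where "b = xx * vv / (1 - vv)"
  define w where "w = 1 - vv"
  define D where "D n = det (K_mat n)" for n
  have bw: "b * w = a"
    using one_minus_vv_nonzero by (simp add: a_def b_def w_def)
  have D1: "D 1 = 1 - a + b" and D2: "D 2 = (1 - a)\<^sup>2 + b"
    by (simp_all only: D_def det_K_mat_1 det_K_mat_2 a_def b_def)
  have D_rec: "D (n + 3) = (1 - a - b) * D (n + 2) + b * D (n + 1)" for n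
    by (simp only: D_def det_K_mat_rec a_def b_def)
  have D3: "D 3 = (1 - a - b) * D 2 + b * D 1" and D4: "D 4 = (1 - a - b) * D 3 + b * D 2"
    using D_rec[of 0] D_rec[of 1]
    by (simp_all only: add_0 one_add_one arith_simps numeral_plus_one flip: numeral_One)
  have "D (k + 3) * w ^ (k + 1) = to_fract (K_num k)"
  proof (induction k rule: K_num.induct)
    case 1
    have "to_fract (K_num 0) = w * (1 - a) ^ 3 + a * (1 - a\<^sup>2)"
      by (simp add: to_fract_power a_def w_def)
    \<comment> \<open>Keeping \<open>b * w\<close> together makes this a polynomial identity in
      \<open>a\<close>, \<open>b\<close>, \<open>w\<close>; the fact \<open>bw\<close> then clears
      \<open>b\<close>.\<close>
    moreover have "D 3 * w = w * (1 - a) ^ 3 + (b * w) * (1 - a\<^sup>2)"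
      unfolding D3 D2 D1 by (simp add: algebra_simps power2_eq_square power3_eq_cube)
    ultimately show ?case by (simp add: bw)
  next
    case 2
    have "to_fract 2 = (2 :: rat poly poly fract)"
      using to_fract_add[of 1 "1 :: rat poly poly"] by simp
    then have "to_fract (K_num 1) = w\<^sup>2 * (1 - a) ^ 4 + w * a * (1 - a) * (1 + a - 2 * a\<^sup>2) + a ^ 4"
      by (simp add: to_fract_power a_def w_def mult.assoc)
    moreover have "D 4 * w\<^sup>2
        = w\<^sup>2 * (1 - a) ^ 4 + w * (b * w) * (1 - a) * (1 + a - 2 * a\<^sup>2) + (b * w)\<^sup>2 * a\<^sup>2"
      unfolding D4 D3 D2 D1
      by (simp add: algebra_simps power2_eq_square power4_eq_xxxx)
    ultimately show ?case by (simp add: bw power2_eq_square power4_eq_xxxx mult.assoc)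
  next
    case (3 k)
    have D_step: "D (Suc (Suc k) + 3) = (1 - a - b) * D (Suc k + 3) + b * D (k + 3)"
      using D_rec[of "k + 2"] by (simp add: numeral_eq_Suc)
    have "D (Suc (Suc k) + 3) * w ^ (Suc (Suc k) + 1)
        = (w * (1 - a) - b * w) * (D (Suc k + 3) * w ^ (Suc k + 1))
          + (b * w) * w * (D (k + 3) * w ^ (k + 1))"
      unfolding D_step by (simp add: algebra_simps)
    also have "\<dots> = to_fract (K_num (Suc (Suc k)))"
      unfolding 3 bw by (simp add: a_def w_def)
    finally show ?case .
  qed
  then show ?thesis
    by (simp only: D_def w_def)
qed

text \<open>At \<open>x = 0\<close> the recursion reduces to multiplication by \<open>1 - v\<close>.
  This gives exactly the power split off in the theorem.\<close>

lemma K_num_at_x_0: "poly (K_num k) 0 = (1 - [:0, 1:]) ^ (k + 1)"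
  by (induction k rule: K_num.induct)
    (simp_all add: X_def V_def power2_eq_square)

text \<open>At \<open>v = 1\<close> the starting values are \<open>x * (1 - x^2)\<close> and
  \<open>x^4\<close>; the choice \<open>x = 2\<close> avoids their roots 0, 1 and -1.\<close>

lemma K_num_at_2_1: "poly (poly (K_num k) [:2:]) 1 \<noteq> 0"
by (induction k rule: K_num.induct) (simp_all add: X_def V_def)

theorem theorem15:
  fixes m :: nat
  assumes "m \<ge> 3"
  shows "\<exists>P :: rat poly poly.
    det (K_mat m) = ((1 - vv) ^ (m - 2) + to_fract P) / (1 - vv) ^ (m - 2) \<and>
    P \<noteq> 0 \<and> poly P 0 = 0 \<and> \<not> (1 - V) dvd P"
proof -
  from assms obtain k where m: "m = k + 3"
    by (metis add.commute le_Suc_ex)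
  define P where "P = K_num k - (1 - V) ^ (k + 1)"
  have "to_fract P = det (K_mat m) * (1 - vv) ^ (k + 1) - (1 - vv) ^ (k + 1)"
    unfolding P_def m det_K_mat by (simp only: to_fract_diff to_fract_power to_fract_1)
  then have det: "det (K_mat m) = ((1 - vv) ^ (m - 2) + to_fract P) / (1 - vv) ^ (m - 2)"
    using one_minus_vv_nonzero by (simp add: m)
  have zero: "poly P 0 = 0"
    by (simp add: P_def K_num_at_x_0 V_def)
  \<comment> \<open>The subtracted power has positive exponent, so it vanishes at
    \<open>v = 1\<close> and \<open>P\<close> takes the value of \<open>K_num k\<close>.\<close>
  have "poly (poly P [:2:]) 1 \<noteq> 0"
    using K_num_at_2_1[of k] by (simp add: P_def V_def)
  then have ndvd: "\<not> (1 - V) dvd P"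
    by (auto simp: V_def elim!: dvdE)
  then have "P \<noteq> 0" by auto
  with det zero ndvd show ?thesis by blast
qed

end
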